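(* Let $D$ be a nearly doubly regular tournament of order $n$. If $n\ge 5$, then $$\zeta(D)\le\dim(D)\le\left\lceil \frac{4n\log n}{n-1}\right\rceil = O(\log n).$$
   Context: $\log$ is the natural logarithm. A tournament is an orientation of a complete graph (finite); it is regular if all in-degrees and out-degrees are equal. A near-regular tournament is a tournament on an even number $N$ of vertices such that the out-degree of each vertex is either $N/2$ or $(N-2)/2$. A nearly doubly regular tournament of order $n$ is a regular tournament on $n$ vertices such that the in-neighbourhood and the out-neighbourhood of each vertex induce near-regular tournaments (this forces $n\equiv 1 \pmod 4$). Distance $d(w,u)$ in a digraph is the length of a shortest directed path from $w$ to $u$, taken to be $\infty$ if there is none. A resolving set of $D$ is a set $R\subseteq V(D)$ such that for each pair of distinct vertices $u,v\notin R$ there is $w\in R$ with $d(w,u)\ne d(w,v)$. The metric dimension $\dim(D)$ is the least size of a resolving set. Localization game on $D$: one player controls a set of cops, the other an invisible robber. The robber first chooses an initial vertex. In each subsequent round the cops move (each cop may choose any vertex to occupy), and then the robber moves along an arc to an out-neighbour or stays. After each robber move, if the cops occupy $u_1,\dots,u_j$, they receive the vector of distances $d(u_i,x)$, $1\le i\le j$, where $x$ is the robber's vertex. The robber is located if in some round there is a unique vertex the robber can occupy that corresponds to the distance vector received (the cops may use information from previous rounds). The localization number $\zeta(D)$ is the minimum number of cops for which there is a strategy guaranteed to locate the robber in a finite number of rounds. *)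

theory Defs
  imports
    "Graph_Theory.Graph_Theory"
    "HOL-Library.Landau_Symbols"
    Complex_Main
begin

locale tournament = digraph +
  assumes unique_orientation:
    "\<lbrakk>u \<in> verts G; v \<in> verts G; u \<noteq> v\<rbrakk> \<Longrightarrow> (u \<rightarrow>\<^bsub>G\<^esub> v) \<noteq> (v \<rightarrow>\<^bsub>G\<^esub> u)"

definition regular_tournament :: "('a, 'b) pre_digraph \<Rightarrow> bool" where
  "regular_tournament G \<longleftrightarrow> tournament G \<and>
     (\<exists>r. \<forall>v\<in>verts G. in_degree G v = r \<and> out_degree G v = r)"

definition near_regular_tournament :: "('a, 'b) pre_digraph \<Rightarrow> bool" where
  "near_regular_tournament G \<longleftrightarrow> tournament G \<and> even (card (verts G)) \<and>
     (\<forall>v\<in>verts G. out_degree G v = card (verts G) div 2 \<or>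
                  out_degree G v = (card (verts G) - 2) div 2)"

definition nearly_doubly_regular_tournament :: "('a, 'b) pre_digraph \<Rightarrow> bool" where
  "nearly_doubly_regular_tournament G \<longleftrightarrow> regular_tournament G \<and>
     (\<forall>v\<in>verts G. near_regular_tournament (G \<restriction> {u. u \<rightarrow>\<^bsub>G\<^esub> v}) \<and>
                  near_regular_tournament (G \<restriction> {u. v \<rightarrow>\<^bsub>G\<^esub> u}))"

(* With unit arc weights the cost of a walk is its number of arcs; the infimum is \<infinity> if there is no walk. *)
definition digraph_dist :: "('a, 'b) pre_digraph \<Rightarrow> 'a \<Rightarrow> 'a \<Rightarrow> ereal" where
  "digraph_dist G w u = wf_digraph.\<mu> G (\<lambda>_. 1) w u"

definition resolving_set :: "('a, 'b) pre_digraph \<Rightarrow> 'a set \<Rightarrow> bool" where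
  "resolving_set G R \<longleftrightarrow> R \<subseteq> verts G \<and>
     (\<forall>u\<in>verts G - R. \<forall>v\<in>verts G - R. u \<noteq> v \<longrightarrow>
        (\<exists>w\<in>R. digraph_dist G w u \<noteq> digraph_dist G w v))"

definition metric_dimension :: "('a, 'b) pre_digraph \<Rightarrow> nat" where
  "metric_dimension G = (LEAST k. \<exists>R. resolving_set G R \<and> card R = k)"

text \<open>
  The localization game. A play of the robber is the sequence of its positions:
  \<open>x 0\<close> is the initial vertex and \<open>x t\<close> is the vertex occupied after its move in round \<open>t \<ge> 1\<close>.
  A strategy of the cops maps the list of distance vectors received so far (oldest first) to the
  list of vertices occupied by the cops in the next round; several cops may share a vertex.
  As such a strategy is deterministic, it wins against every (even adaptive) robber iff it
  wins against every play.
\<close>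

definition robber_play :: "('a, 'b) pre_digraph \<Rightarrow> (nat \<Rightarrow> 'a) \<Rightarrow> bool" where
  "robber_play G x \<longleftrightarrow>
     (\<forall>t. x t \<in> verts G) \<and> (\<forall>t. x (Suc t) = x t \<or> x t \<rightarrow>\<^bsub>G\<^esub> x (Suc t))"

type_synonym 'a cop_strategy = "ereal list list \<Rightarrow> 'a list"

definition valid_strategy :: "('a, 'b) pre_digraph \<Rightarrow> nat \<Rightarrow> 'a cop_strategy \<Rightarrow> bool" where
  "valid_strategy G k \<sigma> \<longleftrightarrow> (\<forall>h. length (\<sigma> h) = k \<and> set (\<sigma> h) \<subseteq> verts G)"

fun observations ::
  "('a, 'b) pre_digraph \<Rightarrow> 'a cop_strategy \<Rightarrow> (nat \<Rightarrow> 'a) \<Rightarrow> nat \<Rightarrow> ereal list list" where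
  "observations G \<sigma> x 0 = []"
| "observations G \<sigma> x (Suc t) =
     observations G \<sigma> x t @
       [map (\<lambda>c. digraph_dist G c (x (Suc t))) (\<sigma> (observations G \<sigma> x t))]"

(* The vertices the robber can occupy after round t, given everything the cops have observed. *)
definition candidates ::
  "('a, 'b) pre_digraph \<Rightarrow> 'a cop_strategy \<Rightarrow> (nat \<Rightarrow> 'a) \<Rightarrow> nat \<Rightarrow> 'a set" where
  "candidates G \<sigma> x t =
     {y t | y. robber_play G y \<and> observations G \<sigma> y t = observations G \<sigma> x t}"

definition winning_strategy :: "('a, 'b) pre_digraph \<Rightarrow> 'a cop_strategy \<Rightarrow> bool" where
  "winning_strategy G \<sigma> \<longleftrightarrow>
     (\<forall>x. robber_play G x \<longrightarrow> (\<exists>t\<ge>1. \<exists>!v. v \<in> candidates G \<sigma> x t))"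

definition localization_number :: "('a, 'b) pre_digraph \<Rightarrow> nat" where
  "localization_number G = (LEAST k. \<exists>\<sigma>. valid_strategy G k \<sigma> \<and> winning_strategy G \<sigma>)"

end

theory Submission
  imports Defs
begin

text \<open>
  A resolving set is a winning cop position. If the cops occupy a resolving set in the first round,
  the distance vector already identifies the robber: a vertex of the set is recognised by the
  distance 0, and the other vertices have pairwise different vectors. So the localization number is
  at most the metric dimension, in every finite digraph
  (\<open>localization_number_le_metric_dimension\<close>).

  In a tournament, being at distance 1 or not from w is already very informative. A vertex w other
  than u and v tells u and v apart as soon as exactly one of u and v beats w, since then exactly one
  of them is at distance 1 from w. Let \<open>r = (n - 1) / 2\<close> be the common degree in a nearly doubly
  regular tournament. For an arc from u to v, near-regularity of the out-neighbourhood of u says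
  that v beats at most half of it; hence u and v have at most \<open>r / 2\<close> common out-neighbours, and
  the symmetric difference of their out-neighbourhoods has at least
  \<open>2 * r - 2 * (r / 2) = r\<close> elements (\<open>card_separators_ge\<close>).

  Thus every pair of vertices is separated by a fraction of at least \<open>q = (n - 1) / (2 * n)\<close> of the
  vertices, and a resolving set is obtained by hitting all these separating sets. Choosing greedily
  a vertex that hits the most sets not yet hit, each choice leaves at most the fraction \<open>1 - q\<close> of
  them, so k choices leave fewer than \<open>n\<^sup>2 * exp (- k * q)\<close> sets (\<open>hitting_set\<close>). This number is
  at most 1 when \<open>k \<ge> 2 * ln n / q = 4 * n * ln n / (n - 1)\<close>.
\<close>

section \<open>Distances in digraphs\<close>

context wf_digraph
begin

lemma awalk_cost_unit: "awalk_cost (\<lambda>_. 1) p = real (length p)"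
  by (induct p) simp_all

lemma digraph_dist_conv:
  "digraph_dist G w u = (INF p\<in>{p. awalk w p u}. ereal (real (length p)))"
  by (simp add: digraph_dist_def \<mu>_def awalk_cost_unit)

lemma digraph_dist_self:
  assumes "w \<in> verts G"
  shows "digraph_dist G w w = 0"
proof (rule antisym)
  have "awalk w [] w" using assms by (simp add: awalk_Nil_iff)
  then show "digraph_dist G w w \<le> 0"
    unfolding digraph_dist_conv by (auto intro!: INF_lower2[of "[]"])
  show "0 \<le> digraph_dist G w w"
    unfolding digraph_dist_conv by (auto intro!: INF_greatest)
qed

lemma digraph_dist_pos:
  assumes "w \<noteq> u"
  shows "0 < digraph_dist G w u"
proof -
  have "1 \<le> digraph_dist G w u"
    unfolding digraph_dist_conv
  proof (rule INF_greatest)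
    fix p assume "p \<in> {p. awalk w p u}"
    then have "p \<noteq> []" using assms by (auto simp: awalk_Nil_iff)
    then show "1 \<le> ereal (real (length p))" by (cases p) auto
  qed
  then show ?thesis by (rule less_le_trans[rotated]) simp
qed

lemma digraph_dist_le_one_iff:
  assumes "w \<noteq> u"
  shows "digraph_dist G w u \<le> 1 \<longleftrightarrow> w \<rightarrow>\<^bsub>G\<^esub> u"
proof
  assume "w \<rightarrow>\<^bsub>G\<^esub> u"
  then obtain e where e: "e \<in> arcs G" "tail G e = w" "head G e = u" by (rule reachableE)
  then have "awalk w [e] u" by (auto simp: awalk_Cons_iff awalk_Nil_iff)
  then show "digraph_dist G w u \<le> 1"
    unfolding digraph_dist_conv by (auto intro!: INF_lower2[of "[e]"])
next
  assume le: "digraph_dist G w u \<le> 1"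
  show "w \<rightarrow>\<^bsub>G\<^esub> u"
  proof (rule ccontr)
    assume non: "\<not> w \<rightarrow>\<^bsub>G\<^esub> u"
    have "2 \<le> digraph_dist G w u"
      unfolding digraph_dist_conv
    proof (rule INF_greatest)
      fix p assume "p \<in> {p. awalk w p u}"
      then have p: "awalk w p u" by simp
      have "p \<noteq> []" using p assms by (auto simp: awalk_Nil_iff)
      then obtain e q where eq: "p = e # q" by (cases p) auto
      have "q \<noteq> []"
      proof
        assume "q = []"
        then have "e \<in> arcs G" "tail G e = w" "head G e = u"
          using p eq by (auto simp: awalk_Cons_iff awalk_Nil_iff)
        then have "w \<rightarrow>\<^bsub>G\<^esub> u" by (auto simp: arcs_ends_conv)
        with non show False by simp
      qed
      then show "2 \<le> ereal (real (length p))" using eq by (cases q) auto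
    qed
    with le have "(2::ereal) \<le> 1" by (rule order_trans[rotated])
    then show False by simp
  qed
qed

end

section \<open>Resolving sets and the localization game\<close>

lemma resolving_set_verts: "resolving_set G (verts G)"
  by (simp add: resolving_set_def)

lemma metric_dimension_le:
  "resolving_set G R \<Longrightarrow> metric_dimension G \<le> card R"
  unfolding metric_dimension_def by (rule Least_le) blast

lemma metric_dimension_attained:
  obtains R where "resolving_set G R" "card R = metric_dimension G"
proof -
  have "\<exists>R. resolving_set G R \<and> card R = metric_dimension G"
    unfolding metric_dimension_def
    by (rule LeastI[of _ "card (verts G)"]) (use resolving_set_verts in blast)
  with that show ?thesis by blast
qed

text \<open>Resolving sets only promise to tell apart vertices outside the set. A vertex of the set is
  the only one at distance 0 from itself, so the promise extends to all pairs.\<close>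

lemma (in wf_digraph) resolving_set_distances_inj:
  assumes R: "resolving_set G R" and uv: "u \<in> verts G" "v \<in> verts G"
    and eq: "\<And>w. w \<in> R \<Longrightarrow> digraph_dist G w u = digraph_dist G w v"
  shows "u = v"
proof (rule ccontr)
  assume neq: "u \<noteq> v"
  have "u \<notin> R"
    using eq[of u] digraph_dist_self[OF uv(1)] digraph_dist_pos[OF neq] by auto
  moreover have "v \<notin> R"
    using eq[of v] digraph_dist_self[OF uv(2)] digraph_dist_pos[of v u] neq by auto
  ultimately show False
    using R uv neq eq unfolding resolving_set_def by (metis DiffI)
qed

lemma (in fin_digraph) localization_number_le_metric_dimension:
  "localization_number G \<le> metric_dimension G"
proof -
  obtain R where R: "resolving_set G R" and card: "card R = metric_dimension G"
    by (rule metric_dimension_attained)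
  have sub: "R \<subseteq> verts G" using R by (simp add: resolving_set_def)
  then have "finite R" by (rule finite_subset) simp
  then obtain cs where cs: "set cs = R" "distinct cs"
    using finite_distinct_list by blast
  \<comment> \<open>The first observation already decides, so the cops never need to move.\<close>
  define \<sigma> :: "'a cop_strategy" where "\<sigma> = (\<lambda>_. cs)"
  have valid: "valid_strategy G (metric_dimension G) \<sigma>"
    using cs sub card distinct_card[of cs] by (auto simp: valid_strategy_def \<sigma>_def)
  have "winning_strategy G \<sigma>"
    unfolding winning_strategy_def
  proof (intro allI impI)
    fix x assume x: "robber_play G x"
    have "v = x 1" if cand: "v \<in> candidates G \<sigma> x 1" for v
    proof -
      obtain y where y: "v = y 1" "robber_play G y"
        and obs: "observations G \<sigma> y 1 = observations G \<sigma> x 1"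
        using cand by (auto simp: candidates_def)
      have "\<forall>w\<in>R. digraph_dist G w (y 1) = digraph_dist G w (x 1)"
        using obs cs by (simp add: \<sigma>_def)
      then have "y 1 = x 1"
        using resolving_set_distances_inj[OF R, of "y 1" "x 1"] x y
        by (auto simp: robber_play_def)
      with y show ?thesis by simp
    qed
    moreover have "x 1 \<in> candidates G \<sigma> x 1"
      using x by (auto simp: candidates_def)
    ultimately show "\<exists>t\<ge>1. \<exists>!v. v \<in> candidates G \<sigma> x t" by blast
  qed
  with valid show ?thesis
    unfolding localization_number_def by (intro Least_le) blast
qed

section \<open>Neighbourhoods in nearly doubly regular tournaments\<close>

lemma (in nomulti_digraph) out_degree_conv: "out_degree G v = card {u. v \<rightarrow>\<^bsub>G\<^esub> u}"
proof -
  have "{u. v \<rightarrow>\<^bsub>G\<^esub> u} = head G ` out_arcs G v"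
    by (auto simp: arcs_ends_conv)
  moreover have "inj_on (head G) (out_arcs G v)"
    by (rule inj_onI) (auto intro!: no_multi_arcs simp: arc_to_ends_def)
  ultimately show ?thesis by (simp add: out_degree_def card_image)
qed

lemma (in nomulti_digraph) in_degree_conv: "in_degree G v = card {u. u \<rightarrow>\<^bsub>G\<^esub> v}"
proof -
  have "{u. u \<rightarrow>\<^bsub>G\<^esub> v} = tail G ` in_arcs G v"
    by (auto simp: arcs_ends_conv)
  moreover have "inj_on (tail G) (in_arcs G v)"
    by (rule inj_onI) (auto intro!: no_multi_arcs simp: arc_to_ends_def)
  ultimately show ?thesis by (simp add: in_degree_def card_image)
qed

lemma (in tournament) degree_sum:
  assumes "v \<in> verts G"
  shows "in_degree G v + out_degree G v + 1 = card (verts G)"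
proof -
  have split: "verts G = insert v ({u. u \<rightarrow>\<^bsub>G\<^esub> v} \<union> {u. v \<rightarrow>\<^bsub>G\<^esub> u})"
    using assms unique_orientation[OF assms] adj_in_verts by blast
  have fin: "finite ({u. u \<rightarrow>\<^bsub>G\<^esub> v} \<union> {u. v \<rightarrow>\<^bsub>G\<^esub> u})"
    using split finite_verts by (metis finite_insert)
  have disj: "{u. u \<rightarrow>\<^bsub>G\<^esub> v} \<inter> {u. v \<rightarrow>\<^bsub>G\<^esub> u} = {}"
    using unique_orientation assms adj_in_verts adj_not_same by blast
  have "v \<notin> {u. u \<rightarrow>\<^bsub>G\<^esub> v} \<union> {u. v \<rightarrow>\<^bsub>G\<^esub> u}"
    using adj_not_same by auto
  then have "card (verts G) = Suc (card ({u. u \<rightarrow>\<^bsub>G\<^esub> v} \<union> {u. v \<rightarrow>\<^bsub>G\<^esub> u}))"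
    using fin by (subst split) simp
  with fin disj show ?thesis
    by (simp add: card_Un_disjoint in_degree_conv out_degree_conv)
qed

lemma dominates_induce_subgraph_iff:
  "u \<rightarrow>\<^bsub>G \<restriction> S\<^esub> v \<longleftrightarrow> u \<in> S \<and> v \<in> S \<and> u \<rightarrow>\<^bsub>G\<^esub> v"
proof -
  have "arcs_ends (G \<restriction> S) = arcs_ends G \<inter> S \<times> S"
    by (auto simp: arcs_ends_conv intro: rev_image_eqI)
  then show ?thesis by auto
qed

text \<open>For an arc from u to v, the common out-neighbours of u and v are the out-neighbours of v
  in the near-regular tournament induced on the out-neighbourhood of u, in which no vertex beats
  more than half of the vertices.\<close>
lemma common_out_neighbours_le:
  assumes D: "nearly_doubly_regular_tournament G" and arc: "u \<rightarrow>\<^bsub>G\<^esub> v"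
  shows "2 * card ({w. u \<rightarrow>\<^bsub>G\<^esub> w} \<inter> {w. v \<rightarrow>\<^bsub>G\<^esub> w}) \<le> card {w. u \<rightarrow>\<^bsub>G\<^esub> w}"
proof -
  let ?N = "{w. u \<rightarrow>\<^bsub>G\<^esub> w}"
  interpret tournament G
    using D by (simp add: nearly_doubly_regular_tournament_def regular_tournament_def)
  have "u \<in> verts G" using arc by (rule adj_in_verts)
  then have near: "near_regular_tournament (G \<restriction> ?N)"
    using D by (simp add: nearly_doubly_regular_tournament_def)
  then interpret N: tournament "G \<restriction> ?N"
    by (simp add: near_regular_tournament_def)
  have "out_degree (G \<restriction> ?N) v \<le> card ?N div 2"
    using near arc by (auto simp: near_regular_tournament_def)
  moreover have "{w. v \<rightarrow>\<^bsub>G \<restriction> ?N\<^esub> w} = ?N \<inter> {w. v \<rightarrow>\<^bsub>G\<^esub> w}"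
    using arc by (auto simp: dominates_induce_subgraph_iff)
  ultimately show ?thesis by (simp add: N.out_degree_conv)
qed

text \<open>Besides the vertices beaten by exactly one of u and v, this contains u and v themselves,
  because a pair that meets the chosen set needs no separation.\<close>

definition separators :: "('a, 'b) pre_digraph \<Rightarrow> 'a \<Rightarrow> 'a \<Rightarrow> 'a set" where
  "separators G u v = {u, v} \<union> sym_diff {w. u \<rightarrow>\<^bsub>G\<^esub> w} {w. v \<rightarrow>\<^bsub>G\<^esub> w}"

lemma separators_commute: "separators G u v = separators G v u"
  by (auto simp: separators_def)

lemma (in wf_digraph) separators_subset:
  "u \<in> verts G \<Longrightarrow> v \<in> verts G \<Longrightarrow> separators G u v \<subseteq> verts G"
  by (auto simp: separators_def dest: adj_in_verts)

text \<open>Membership in \<open>separators\<close> speaks of arcs leaving u and v, while distances from w depend on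
  arcs leaving w. In a tournament w beats u exactly if u does not beat w, so w also beats exactly one
  of u and v, and this one is at distance 1.\<close>

lemma (in tournament) separators_separate:
  assumes "u \<in> verts G" "v \<in> verts G" "w \<in> separators G u v" "w \<noteq> u" "w \<noteq> v"
  shows "digraph_dist G w u \<noteq> digraph_dist G w v"
proof -
  have "w \<in> verts G" using assms separators_subset by blast
  then have "(w \<rightarrow>\<^bsub>G\<^esub> u) \<noteq> (w \<rightarrow>\<^bsub>G\<^esub> v)"
    using assms unique_orientation[of w u] unique_orientation[of w v]
    by (auto simp: separators_def)
  then show ?thesis
    using digraph_dist_le_one_iff[of w u] digraph_dist_le_one_iff[of w v] assms by auto
qed

lemma (in tournament) resolving_set_if_meets_separators:
  assumes "R \<subseteq> verts G"
    and "\<And>u v. u \<in> verts G \<Longrightarrow> v \<in> verts G \<Longrightarrow> u \<noteq> v \<Longrightarrow> separators G u v \<inter> R \<noteq> {}"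
  shows "resolving_set G R"
  unfolding resolving_set_def
proof (intro conjI ballI impI)
  fix u v assume u: "u \<in> verts G - R" and v: "v \<in> verts G - R" and "u \<noteq> v"
  then obtain w where "w \<in> separators G u v" "w \<in> R" using assms(2)[of u v] by auto
  with u v show "\<exists>w\<in>R. digraph_dist G w u \<noteq> digraph_dist G w v"
    using separators_separate[of u v w] by auto
qed fact

text \<open>With r the common degree, the number of vertices is \<open>2 * r + 1\<close>, so the claim is that there are
  at least r separators. Each out-neighbourhood has r elements, and the two share at most half of
  them.\<close>

lemma card_separators_ge:
  assumes D: "nearly_doubly_regular_tournament G"
    and "u \<in> verts G" "v \<in> verts G" "u \<noteq> v"
  shows "card (verts G) \<le> 2 * card (separators G u v) + 1"
proof -
  interpret tournament G
    using D by (simp add: nearly_doubly_regular_tournament_def regular_tournament_def)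
  obtain r where r: "\<And>v. v \<in> verts G \<Longrightarrow> in_degree G v = r \<and> out_degree G v = r"
    using D by (auto simp: nearly_doubly_regular_tournament_def regular_tournament_def)
  have n: "card (verts G) = 2 * r + 1"
    using degree_sum[OF assms(2)] r[OF assms(2)] by simp
  have arc_case: "r \<le> card (separators G a b)" if "a \<rightarrow>\<^bsub>G\<^esub> b" for a b
  proof -
    let ?A = "{w. a \<rightarrow>\<^bsub>G\<^esub> w}" and ?B = "{w. b \<rightarrow>\<^bsub>G\<^esub> w}"
    have ab: "a \<in> verts G" "b \<in> verts G" using that adj_in_verts by auto
    have fin: "finite ?A" "finite ?B"
      by (rule finite_subset[of _ "verts G"]; use adj_in_verts in auto)+
    have cards: "card ?A = r" "card ?B = r"
      using r ab by (simp_all flip: out_degree_conv)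
    have "card (?A - ?B) = r - card (?A \<inter> ?B)" "card (?B - ?A) = r - card (?A \<inter> ?B)"
      using cards fin by (simp_all add: card_Diff_subset_Int Int_commute)
    then have "card (sym_diff ?A ?B) = 2 * r - 2 * card (?A \<inter> ?B)"
      using fin by (subst card_Un_disjoint) auto
    moreover have "2 * card (?A \<inter> ?B) \<le> r"
      using common_out_neighbours_le[OF D that] cards by simp
    moreover have "card (sym_diff ?A ?B) \<le> card (separators G a b)"
      using fin by (intro card_mono) (auto simp: separators_def)
    ultimately show ?thesis by linarith
  qed
  have "u \<rightarrow>\<^bsub>G\<^esub> v \<or> v \<rightarrow>\<^bsub>G\<^esub> u" using unique_orientation assms by blast
  then have "r \<le> card (separators G u v)"
    using arc_case separators_commute[of G u v] by metis
  with n show ?thesis by simp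
qed

section \<open>Small hitting sets for families of large sets\<close>

text \<open>Double counting the pairs of an element and a set containing it: on average, an element of V
  lies in a fraction of at least \<open>d / card V\<close> of the sets.\<close>

lemma popular_element:
  fixes A :: "'i \<Rightarrow> 'a set" and d :: real
  assumes fin: "finite V" "finite J" and "V \<noteq> {}"
    and A: "\<And>i. i \<in> J \<Longrightarrow> A i \<subseteq> V" "\<And>i. i \<in> J \<Longrightarrow> d \<le> real (card (A i))"
  obtains w where "w \<in> V" "d / real (card V) * real (card J) \<le> real (card {i\<in>J. w \<in> A i})"
proof -
  have "(\<Sum>w\<in>V. card {i\<in>J. w \<in> A i}) = (\<Sum>i\<in>J. card (A i))"
    by (rule sum_multicount_gen) (use fin A(1) in \<open>auto intro!: arg_cong[where f = card]\<close>)
  then have "(\<Sum>w\<in>V. real (card {i\<in>J. w \<in> A i})) = (\<Sum>i\<in>J. real (card (A i)))"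
    by (simp flip: of_nat_sum)
  also have "\<dots> \<ge> (\<Sum>i\<in>J. d)" using A(2) by (rule sum_mono)
  finally have avg: "real (card J) * d \<le> (\<Sum>w\<in>V. real (card {i\<in>J. w \<in> A i}))" by simp
  have "\<exists>w\<in>V. d / real (card V) * real (card J) \<le> real (card {i\<in>J. w \<in> A i})"
  proof (rule ccontr)
    assume "\<not> ?thesis"
    then have "(\<Sum>w\<in>V. real (card {i\<in>J. w \<in> A i})) < (\<Sum>w\<in>V. d / real (card V) * real (card J))"
      using fin \<open>V \<noteq> {}\<close> by (intro sum_strict_mono) (simp_all add: not_le)
    also have "\<dots> = real (card J) * d" using fin \<open>V \<noteq> {}\<close> by simp
    finally show False using avg by simp
  qed
  with that show ?thesis by blast
qed

text \<open>Adding an element that is popular among the sets still missed multiplies their number by at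
  most \<open>1 - d / card V\<close>.\<close>

lemma greedy_hitting:
  fixes A :: "'i \<Rightarrow> 'a set" and d :: real
  assumes fin: "finite V" "finite I" and "V \<noteq> {}" and d: "d \<le> real (card V)"
    and A: "\<And>i. i \<in> I \<Longrightarrow> A i \<subseteq> V" "\<And>i. i \<in> I \<Longrightarrow> d \<le> real (card (A i))"
  shows "\<exists>R\<subseteq>V. card R \<le> k \<and>
    real (card {i\<in>I. A i \<inter> R = {}}) \<le> (1 - d / real (card V)) ^ k * real (card I)"
proof (induction k)
  case 0
  show ?case by (rule exI[of _ "{}"]) simp
next
  case (Suc k)
  let ?q = "d / real (card V)"
  obtain R where R: "R \<subseteq> V" "card R \<le> k"
    and le: "real (card {i\<in>I. A i \<inter> R = {}}) \<le> (1 - ?q) ^ k * real (card I)"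
    using Suc.IH by blast
  define J where "J = {i\<in>I. A i \<inter> R = {}}"
  have finJ: "finite J" using fin by (simp add: J_def)
  obtain w where w: "w \<in> V" "?q * real (card J) \<le> real (card {i\<in>J. w \<in> A i})"
    by (rule popular_element[OF fin(1) finJ \<open>V \<noteq> {}\<close>, of A d]) (use A in \<open>auto simp: J_def\<close>)
  have "{i\<in>I. A i \<inter> insert w R = {}} = J - {i\<in>J. w \<in> A i}" by (auto simp: J_def)
  then have "real (card {i\<in>I. A i \<inter> insert w R = {}}) = real (card J) - real (card {i\<in>J. w \<in> A i})"
    using finJ by (simp add: card_Diff_subset card_mono of_nat_diff)
  also have "\<dots> \<le> (1 - ?q) * real (card J)" using w by (simp add: algebra_simps)
  also have "\<dots> \<le> (1 - ?q) * ((1 - ?q) ^ k * real (card I))"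
    using le d fin \<open>V \<noteq> {}\<close> by (intro mult_left_mono) (auto simp: J_def divide_le_eq_1 card_gt_0_iff)
  finally have "real (card {i\<in>I. A i \<inter> insert w R = {}}) \<le> (1 - ?q) ^ Suc k * real (card I)"
    by (simp add: mult.assoc)
  moreover have "card (insert w R) \<le> Suc k" using R(2) by (metis card_insert_le_m1 diff_Suc_1 zero_less_Suc)
  ultimately show ?case using R(1) w(1) by (intro exI[of _ "insert w R"]) auto
qed

text \<open>Since \<open>1 - q \<le> exp (- q)\<close>, the condition on k makes the number of sets missed by the greedy
  choice smaller than 1, hence 0.\<close>

lemma hitting_set:
  fixes A :: "'i \<Rightarrow> 'a set" and d :: real
  assumes fin: "finite V" "finite I" and "V \<noteq> {}" and d: "d \<le> real (card V)"
    and A: "\<And>i. i \<in> I \<Longrightarrow> A i \<subseteq> V" "\<And>i. i \<in> I \<Longrightarrow> d \<le> real (card (A i))"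
    and k: "real (card I) < exp (real k * (d / real (card V)))"
  obtains R where "R \<subseteq> V" "card R \<le> k" "\<And>i. i \<in> I \<Longrightarrow> A i \<inter> R \<noteq> {}"
proof -
  let ?q = "d / real (card V)"
  obtain R where R: "R \<subseteq> V" "card R \<le> k"
    and le: "real (card {i\<in>I. A i \<inter> R = {}}) \<le> (1 - ?q) ^ k * real (card I)"
    using greedy_hitting[OF fin \<open>V \<noteq> {}\<close> d, of A k] A by blast
  have "0 \<le> 1 - ?q" using d fin \<open>V \<noteq> {}\<close> by (simp add: divide_le_eq_1 card_gt_0_iff)
  moreover have "1 - ?q \<le> exp (- ?q)" using exp_ge_add_one_self[of "- ?q"] by simp
  ultimately have "(1 - ?q) ^ k \<le> exp (- ?q) ^ k" by (intro power_mono)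
  also have "\<dots> = exp (- (real k * ?q))" by (simp flip: exp_of_nat_mult)
  finally have "(1 - ?q) ^ k * real (card I) \<le> exp (- (real k * ?q)) * real (card I)"
    by (rule mult_right_mono) simp
  also have "\<dots> < exp (- (real k * ?q)) * exp (real k * ?q)"
    using k by (intro mult_strict_left_mono) auto
  also have "\<dots> = 1" by (simp flip: exp_add)
  finally have "card {i\<in>I. A i \<inter> R = {}} = 0" using le by linarith
  then have "{i\<in>I. A i \<inter> R = {}} = {}" using fin by simp
  with R that show ?thesis by blast
qed

section \<open>The bounds\<close>

text \<open>There are fewer than \<open>n\<^sup>2 = exp (2 * ln n)\<close> pairs to separate, and the bound is the value of k
  for which k times the fraction \<open>(n - 1) / (2 * n)\<close> of separators reaches \<open>2 * ln n\<close>.\<close>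

lemma metric_dimension_nearly_doubly_regular_le:
  assumes D: "nearly_doubly_regular_tournament G" and n: "card (verts G) = n" "2 \<le> n"
  shows "int (metric_dimension G) \<le> \<lceil>4 * real n * ln (real n) / (real n - 1)\<rceil>"
proof -
  interpret tournament G
    using D by (simp add: nearly_doubly_regular_tournament_def regular_tournament_def)
  define x where "x = 4 * real n * ln (real n) / (real n - 1)"
  define k where "k = nat \<lceil>x\<rceil>"
  define I where "I = {(u, v). u \<in> verts G \<and> v \<in> verts G \<and> u \<noteq> v}"
  have finI: "finite I"
    by (rule finite_subset[of _ "verts G \<times> verts G"]) (auto simp: I_def)
  have "I \<subset> verts G \<times> verts G"
  proof -
    obtain v where "v \<in> verts G" using n by fastforce
    then have "(v, v) \<in> verts G \<times> verts G - I" by (simp add: I_def)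
    then show ?thesis by (auto simp: I_def)
  qed
  then have "card I < card (verts G \<times> verts G)"
    by (rule psubset_card_mono[rotated]) simp
  then have "card I < n * n" using n by simp
  then have "real (card I) < real n * real n" by (metis of_nat_less_iff of_nat_mult)
  also have "real n * real n = exp (2 * ln (real n))"
    using n by (simp add: exp_double power2_eq_square)
  also have "2 * ln (real n) = x * ((real n - 1) / 2 / real n)"
    using n by (simp add: x_def field_simps)
  also have "exp \<dots> \<le> exp (real k * ((real n - 1) / 2 / real n))"
  proof -
    have "x \<le> real k" unfolding k_def by (rule real_nat_ceiling_ge)
    then have "x * ((real n - 1) / 2 / real n) \<le> real k * ((real n - 1) / 2 / real n)"
      by (rule mult_right_mono) (use n in simp)
    then show ?thesis by (simp only: exp_le_cancel_iff)
  qed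
  finally have k: "real (card I) < exp (real k * ((real n - 1) / 2 / real (card (verts G))))"
    using n by simp
  have ne: "verts G \<noteq> {}" using n by auto
  obtain R where R: "R \<subseteq> verts G" "card R \<le> k"
    and hit: "\<And>i. i \<in> I \<Longrightarrow> case_prod (separators G) i \<inter> R \<noteq> {}"
  proof (rule hitting_set[OF finite_verts finI ne _ _ _ k, of "case_prod (separators G)"])
    show "(real n - 1) / 2 \<le> real (card (verts G))" using n by simp
    show "case_prod (separators G) i \<subseteq> verts G" if "i \<in> I" for i
      using that separators_subset by (auto simp: I_def)
    show "(real n - 1) / 2 \<le> real (card (case_prod (separators G) i))" if "i \<in> I" for i
    proof -
      obtain u v where "i = (u, v)" "u \<in> verts G" "v \<in> verts G" "u \<noteq> v"
        using \<open>i \<in> I\<close> by (auto simp: I_def)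
      then show ?thesis using card_separators_ge[OF D, of u v] n by auto
    qed
  qed blast
  have "resolving_set G R"
    by (rule resolving_set_if_meets_separators[OF R(1)]) (use hit in \<open>force simp: I_def\<close>)
  then have "metric_dimension G \<le> k" using R(2) metric_dimension_le by (metis order_trans)
  moreover have "0 \<le> x" using n by (simp add: x_def)
  ultimately have "int (metric_dimension G) \<le> \<lceil>x\<rceil>" by (simp add: k_def le_nat_iff)
  then show ?thesis by (simp add: x_def)
qed

text \<open>For \<open>n \<ge> 3\<close> the factor \<open>4 * n / (n - 1)\<close> is at most 8, and \<open>ln n \<ge> 1\<close> absorbs the rounding,
  which gives the constant 9.\<close>

lemma bound_bigo_ln:
  "(\<lambda>n::nat. real_of_int \<lceil>4 * real n * ln (real n) / (real n - 1)\<rceil>) \<in> O(\<lambda>n. ln (real n))"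
proof (rule bigoI[where c = 9])
  show "\<forall>\<^sub>F n in sequentially.
    norm (real_of_int \<lceil>4 * real n * ln (real n) / (real n - 1)\<rceil>) \<le> 9 * norm (ln (real n))"
    using eventually_ge_at_top[of 3]
  proof eventually_elim
    case (elim n)
    let ?x = "4 * real n * ln (real n) / (real n - 1)"
    have "exp 1 \<le> real n" using exp_le elim by linarith
    then have ln: "1 \<le> ln (real n)" using elim by (subst ln_ge_iff) auto
    have "4 * real n / (real n - 1) \<le> 8" using elim by (simp add: divide_le_eq)
    then have "4 * real n / (real n - 1) * ln (real n) \<le> 8 * ln (real n)"
      using ln by (intro mult_right_mono) auto
    then have "?x \<le> 8 * ln (real n)" by simp
    moreover have "0 \<le> ?x" using elim ln by simp
    moreover have "real_of_int \<lceil>?x\<rceil> \<le> ?x + 1" by linarith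
    moreover have "?x \<le> real_of_int \<lceil>?x\<rceil>" by (rule le_of_int_ceiling)
    ultimately show ?case using ln unfolding real_norm_def by linarith
  qed
qed

theorem theorem2p11:
  shows "(\<forall>(D :: ('a, 'b) pre_digraph) n.
            nearly_doubly_regular_tournament D \<and> card (verts D) = n \<and> n \<ge> 5 \<longrightarrow>
              localization_number D \<le> metric_dimension D \<and>
              int (metric_dimension D) \<le> \<lceil>4 * real n * ln (real n) / (real n - 1)\<rceil>) \<and>
         (\<lambda>n::nat. real_of_int \<lceil>4 * real n * ln (real n) / (real n - 1)\<rceil>) \<in> O(\<lambda>n. ln (real n))"
proof (intro conjI allI impI)
  fix D :: "('a, 'b) pre_digraph" and n
  assume *: "nearly_doubly_regular_tournament D \<and> card (verts D) = n \<and> n \<ge> 5"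
  then interpret tournament D
    by (simp add: nearly_doubly_regular_tournament_def regular_tournament_def)
  show "localization_number D \<le> metric_dimension D"
    by (rule localization_number_le_metric_dimension)
  show "int (metric_dimension D) \<le> \<lceil>4 * real n * ln (real n) / (real n - 1)\<rceil>"
    using * by (intro metric_dimension_nearly_doubly_regular_le) auto
qed (rule bound_bigo_ln)

end
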